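(* Let $A$ be a uniform algebra, let $\Omega=\partial A$ be its Shilov boundary, and let $f$ be a strictly positive continuous function on $\Omega$. Then the following conditions are equivalent: 1. $f\in Q$; 2. $A$ and $Af$ are $A$-module isometric; 3. $A$ and $Af$ are linearly isometric. Indeed, if $f_1,f_2\in C(\partial A)$ are strictly positive, then $Af_1\cong Af_2$ $A$-isometrically if and only if $f_1f_2^{-1}\in Q$.
   Context: A uniform algebra on a compact Hausdorff space $\Omega$ is a closed subalgebra of $C(\Omega)$ (complex continuous functions, sup norm) which contains the constants and separates points; here $A$ is regarded as a uniform algebra on its Shilov boundary $\partial A$. $Q=\{|g|:g\in A^{-1}\}\subset C(\partial A)$, where $A^{-1}$ is the set of invertible elements of $A$. $Af=\{af:a\in A\}\subset C(\partial A)$ with sup norm, an $A$-module under multiplication. $A$-module isometric ($A$-isometric) means there is a surjective isometric $A$-module isomorphism; linearly isometric means there is a surjective linear isometry. *)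

theory Defs
  imports "HOL-Analysis.Analysis"
begin

text \<open>
  For compact \<open>X\<close>, the points of \<open>CC X\<close> are the continuous complex functions on \<open>X\<close> (extended by
  \<open>undefined\<close> off \<open>X\<close>, hence the use of restricted abstractions below), with the
  sup distance.
\<close>

abbreviation CC :: "'x topology \<Rightarrow> ('x \<Rightarrow> complex) metric" where
  "CC X \<equiv> cfunspace X euclidean_metric"

text \<open>Closure under scalar multiplication follows from \<open>const\<close> and \<open>mult\<close>.\<close>

locale uniform_algebra =
  fixes X :: "'x topology" and A :: "('x \<Rightarrow> complex) set"
  assumes compact: "compact_space X"
    and Hausdorff: "Hausdorff_space X"
    and closed: "closedin (mtopology_of (CC X)) A"
    and const: "\<And>c. (\<lambda>x\<in>topspace X. c) \<in> A"
    and add: "\<And>a b. a \<in> A \<Longrightarrow> b \<in> A \<Longrightarrow> (\<lambda>x\<in>topspace X. a x + b x) \<in> A"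
    and mult: "\<And>a b. a \<in> A \<Longrightarrow> b \<in> A \<Longrightarrow> (\<lambda>x\<in>topspace X. a x * b x) \<in> A"
    and separates: "\<And>x y. x \<in> topspace X \<Longrightarrow> y \<in> topspace X \<Longrightarrow> x \<noteq> y \<Longrightarrow> \<exists>a\<in>A. a x \<noteq> a y"

text \<open>Every function in \<open>A\<close> attains its maximum modulus over \<open>X\<close> at a point of \<open>S\<close>.\<close>

definition closed_boundary :: "'x topology \<Rightarrow> ('x \<Rightarrow> complex) set \<Rightarrow> 'x set \<Rightarrow> bool" where
  "closed_boundary X A S \<longleftrightarrow>
     closedin X S \<and> (\<forall>a\<in>A. \<forall>x\<in>topspace X. \<exists>s\<in>S. cmod (a x) \<le> cmod (a s))"

text \<open>The smallest closed boundary with respect to inclusion; for a uniform algebra it exists by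
  Shilov's theorem.\<close>

definition shilov_boundary :: "'x topology \<Rightarrow> ('x \<Rightarrow> complex) set \<Rightarrow> 'x set" where
  "shilov_boundary X A = (LEAST S. closed_boundary X A S)"

definition restrict_algebra :: "('x \<Rightarrow> complex) set \<Rightarrow> 'x topology \<Rightarrow> ('x \<Rightarrow> complex) set" where
  "restrict_algebra A Y = (\<lambda>a. restrict a (topspace Y)) ` A"

definition invertibles :: "'x topology \<Rightarrow> ('x \<Rightarrow> complex) set \<Rightarrow> ('x \<Rightarrow> complex) set" where
  "invertibles Y B = {g \<in> B. \<exists>h\<in>B. \<forall>y\<in>topspace Y. g y * h y = 1}"

definition Q :: "'x topology \<Rightarrow> ('x \<Rightarrow> complex) set \<Rightarrow> ('x \<Rightarrow> real) set" where
  "Q Y B = (\<lambda>g. \<lambda>y\<in>topspace Y. cmod (g y)) ` invertibles Y B"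

definition positive_functions :: "'x topology \<Rightarrow> ('x \<Rightarrow> real) set" where
  "positive_functions Y = {f \<in> mspace (cfunspace Y euclidean_metric). \<forall>y\<in>topspace Y. 0 < f y}"

text \<open>The module \<open>B f \<subseteq> C(Y)\<close>.\<close>

definition mult_module ::
    "'x topology \<Rightarrow> ('x \<Rightarrow> complex) set \<Rightarrow> ('x \<Rightarrow> real) \<Rightarrow> ('x \<Rightarrow> complex) set" where
  "mult_module Y B f = (\<lambda>b. \<lambda>y\<in>topspace Y. b y * of_real (f y)) ` B"

text \<open>\<open>E\<close> and \<open>F\<close> are linear subspaces of \<open>C(Y)\<close> with the sup norm.\<close>

definition surjective_linear_isometry ::
    "'x topology \<Rightarrow> ('x \<Rightarrow> complex) set \<Rightarrow> ('x \<Rightarrow> complex) set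
      \<Rightarrow> (('x \<Rightarrow> complex) \<Rightarrow> ('x \<Rightarrow> complex)) \<Rightarrow> bool" where
  "surjective_linear_isometry Y E F T \<longleftrightarrow>
     T ` E = F \<and>
     (\<forall>u\<in>E. \<forall>v\<in>E. T (\<lambda>y\<in>topspace Y. u y + v y) = (\<lambda>y\<in>topspace Y. T u y + T v y)) \<and>
     (\<forall>c. \<forall>u\<in>E. T (\<lambda>y\<in>topspace Y. c * u y) = (\<lambda>y\<in>topspace Y. c * T u y)) \<and>
     (\<forall>u\<in>E. \<forall>v\<in>E. mdist (CC Y) (T u) (T v) = mdist (CC Y) u v)"

definition linearly_isometric ::
    "'x topology \<Rightarrow> ('x \<Rightarrow> complex) set \<Rightarrow> ('x \<Rightarrow> complex) set \<Rightarrow> bool" where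
  "linearly_isometric Y E F \<longleftrightarrow> (\<exists>T. surjective_linear_isometry Y E F T)"

definition module_isometric ::
    "'x topology \<Rightarrow> ('x \<Rightarrow> complex) set \<Rightarrow> ('x \<Rightarrow> complex) set \<Rightarrow> ('x \<Rightarrow> complex) set \<Rightarrow> bool" where
  "module_isometric Y B E F \<longleftrightarrow>
     (\<exists>T. surjective_linear_isometry Y E F T \<and>
          (\<forall>b\<in>B. \<forall>u\<in>E. T (\<lambda>y\<in>topspace Y. b y * u y) = (\<lambda>y\<in>topspace Y. b y * T u y)))"

end

theory Submission
  imports Defs
begin

text \<open>
  On the Shilov boundary every nonempty open set carries weighted peak functions \<open>b f\<close>, with norm
  \<open>1\<close> and small off the set. They show that \<open>sup \<bar>b\<bar> u = sup \<bar>b\<bar> v\<close> for all \<open>b \<in> B\<close> forces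
  \<open>u = v\<close>; as a module isometry \<open>B f\<^sub>1 \<rightarrow> B f\<^sub>2\<close> has the form \<open>b f\<^sub>1 \<mapsto> b h f\<^sub>2\<close> with \<open>h\<close> invertible,
  it follows that \<open>f\<^sub>1 / f\<^sub>2 = \<bar>h\<bar>\<close>. For a linear isometry \<open>T : B \<rightarrow> B f\<close> they show that each
  evaluation of \<open>T\<close> is, up to a unimodular factor, approximated on finitely many functions by
  evaluations on \<open>B\<close>. Hence \<open>\<bar>T 1\<bar> = 1\<close> and \<open>T a T b = T 1 T (a b)\<close>, which yields \<open>f \<in> Q\<close> on
  taking \<open>T a = T b = f\<close>.
\<close>

section \<open>Continuous functions on compact spaces\<close>

lemma continuous_map_complex_mult [continuous_intros]:
  fixes f g :: "'a \<Rightarrow> complex"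
  shows "\<lbrakk>continuous_map Y euclidean f; continuous_map Y euclidean g\<rbrakk>
    \<Longrightarrow> continuous_map Y euclidean (\<lambda>y. f y * g y)"
  by (simp add: continuous_map_atin tendsto_mult)

lemma continuous_map_complex_of_real [continuous_intros]:
  "continuous_map Y euclideanreal f \<Longrightarrow> continuous_map Y euclidean (\<lambda>y. complex_of_real (f y))"
  by (simp add: continuous_map_atin tendsto_of_real)

lemma continuous_map_restrict_topspace_iff:
  "continuous_map Y Z (\<lambda>y\<in>topspace Y. f y) \<longleftrightarrow> continuous_map Y Z f"
  by (auto intro: continuous_map_eq)

lemma mspace_cfunspace_compact:
  fixes Y :: "'x topology"
  assumes "compact_space Y"
  shows "mspace (cfunspace Y (euclidean_metric :: 'b::metric_space metric)) =
    {f \<in> extensional (topspace Y). continuous_map Y euclidean f}"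
  using assms
  by (subst compactin_mspace_cfunspace) (auto simp: compact_space_def)

lemma compactin_attains_sup:
  fixes f :: "'a \<Rightarrow> real"
  assumes "compactin Y S" "S \<noteq> {}" "continuous_map Y euclidean f"
  obtains s where "s \<in> S" "\<And>t. t \<in> S \<Longrightarrow> f t \<le> f s"
proof -
  have "compact (f ` S)"
    using image_compactin[OF assms(1,3)] by simp
  then show thesis
    using compact_attains_sup[of "f ` S"] assms(2) that by auto
qed

lemma compact_space_bounded_family:
  fixes F :: "('a \<Rightarrow> 'b::real_normed_vector) set"
  assumes "compact_space Y" "finite F" "\<And>f. f \<in> F \<Longrightarrow> continuous_map Y euclidean f"
  obtains C where "1 \<le> C" "\<And>f y. f \<in> F \<Longrightarrow> y \<in> topspace Y \<Longrightarrow> norm (f y) \<le> C"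
proof -
  have "\<exists>C\<ge>1. \<forall>f\<in>F. \<forall>y\<in>topspace Y. norm (f y) \<le> C"
    using assms(2,3)
  proof (induction F rule: finite_induct)
    case empty
    then show ?case by auto
  next
    case (insert f F)
    then obtain C where C: "C \<ge> 1" "\<forall>f\<in>F. \<forall>y\<in>topspace Y. norm (f y) \<le> C"
      by auto
    have "compact (f ` topspace Y)"
      using image_compactin[of Y "topspace Y" euclidean f] assms(1) insert.prems
      by (simp add: compact_space_def)
    then obtain D where "\<forall>y\<in>topspace Y. norm (f y) \<le> D"
      using compact_imp_bounded by (fastforce simp: bounded_iff)
    with C show ?case
      by (intro exI[of _ "max C D"]) fastforce
  qed
  then show thesis
    using that by auto
qed

text \<open>Sets of this form serve as basic neighbourhoods: they are what is deleted from a closed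
  boundary, and where \<open>approximate_evaluation\<close> localises a peak function.\<close>

lemma openin_norm_less_one:
  fixes F :: "('a \<Rightarrow> 'b::real_normed_vector) set"
  assumes "finite F" "\<And>f. f \<in> F \<Longrightarrow> continuous_map Y euclidean f"
  shows "openin Y {y \<in> topspace Y. \<forall>f\<in>F. norm (f y) < 1}"
proof (cases "F = {}")
  case False
  have "openin Y {y \<in> topspace Y. norm (f y) < 1}" if "f \<in> F" for f
    using openin_continuous_map_preimage[of Y euclideanreal "\<lambda>y. norm (f y)" "{..<1}"]
      assms(2)[OF that] by (simp add: continuous_map_norm)
  then have "openin Y (\<Inter>f\<in>F. {y \<in> topspace Y. norm (f y) < 1})"
    using assms(1) False by (intro openin_Inter) auto
  moreover have "(\<Inter>f\<in>F. {y \<in> topspace Y. norm (f y) < 1}) = {y \<in> topspace Y. \<forall>f\<in>F. norm (f y) < 1}"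
    using False by auto
  ultimately show ?thesis by simp
qed auto

section \<open>Closed boundaries of a function algebra\<close>

text \<open>The part of the structure of a uniform algebra that passes to closed boundaries.\<close>

locale function_algebra =
  fixes Y :: "'x topology" and B :: "('x \<Rightarrow> complex) set"
  assumes compact: "compact_space Y"
    and ext: "b \<in> B \<Longrightarrow> b \<in> extensional (topspace Y)"
    and cont: "b \<in> B \<Longrightarrow> continuous_map Y euclidean b"
    and const: "\<And>c. (\<lambda>y\<in>topspace Y. c) \<in> B"
    and add: "\<And>a b. a \<in> B \<Longrightarrow> b \<in> B \<Longrightarrow> (\<lambda>y\<in>topspace Y. a y + b y) \<in> B"
    and mult: "\<And>a b. a \<in> B \<Longrightarrow> b \<in> B \<Longrightarrow> (\<lambda>y\<in>topspace Y. a y * b y) \<in> B"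
begin

lemma scale: "a \<in> B \<Longrightarrow> (\<lambda>y\<in>topspace Y. c * a y) \<in> B"
  using mult[OF const[of c], of a] by (simp cong: restrict_cong)

lemma power: "a \<in> B \<Longrightarrow> (\<lambda>y\<in>topspace Y. a y ^ n) \<in> B"
proof (induction n)
  case 0
  show ?case using const[of 1] by (simp only: power_0)
next
  case (Suc n)
  have "(\<lambda>y\<in>topspace Y. a y ^ Suc n) = (\<lambda>y\<in>topspace Y. a y * (\<lambda>y\<in>topspace Y. a y ^ n) y)"
    by auto
  then show ?case using mult Suc by metis
qed

lemma closed_boundary_topspace: "closed_boundary Y B (topspace Y)"
  unfolding closed_boundary_def by auto

text \<open>The constant \<open>1\<close> serves when the offending function vanishes identically.\<close>

lemma not_closed_boundaryE:
  assumes "\<not> closed_boundary Y B S" "closedin Y S"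
  obtains a M q where "a \<in> B" "0 < M" "0 \<le> q" "q < 1"
    "\<And>y. y \<in> topspace Y \<Longrightarrow> cmod (a y) \<le> M"
    "\<And>s. s \<in> S \<Longrightarrow> cmod (a s) \<le> q * M"
    "\<exists>y\<in>topspace Y. cmod (a y) = M"
proof -
  from assms obtain a x where a: "a \<in> B" "x \<in> topspace Y" "\<forall>s\<in>S. cmod (a s) < cmod (a x)"
    unfolding closed_boundary_def by (auto simp: not_le)
  have S: "compactin Y S"
    using closedin_compact_space[OF compact assms(2)] .
  show thesis
  proof (cases "S = {}")
    case True
    show thesis
    proof (rule that[of "\<lambda>y\<in>topspace Y. 1" 1 0])
      show "\<exists>y\<in>topspace Y. cmod ((\<lambda>y\<in>topspace Y. 1) y) = 1"
        using a(2) by auto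
    qed (use True const[of 1] in auto)
  next
    case False
    have ca: "continuous_map Y euclidean (\<lambda>y. cmod (a y))"
      using cont[OF a(1)] by (rule continuous_map_norm)
    obtain s where s: "s \<in> S" "\<And>t. t \<in> S \<Longrightarrow> cmod (a t) \<le> cmod (a s)"
      using compactin_attains_sup[OF S False ca] by blast
    obtain z where z: "z \<in> topspace Y" "\<And>t. t \<in> topspace Y \<Longrightarrow> cmod (a t) \<le> cmod (a z)"
      using compactin_attains_sup[of Y "topspace Y", OF _ _ ca] compact a(2)
      unfolding compact_space_def by blast
    \<comment> \<open>Maxima over the compact sets \<open>S\<close> and \<open>topspace Y\<close>
      turn the pointwise strict inequality into one ratio below 1.\<close>
    have "cmod (a s) < cmod (a z)"
      using a s z by (meson less_le_trans)
    then have "0 < cmod (a z)"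
      by (meson norm_ge_zero le_less_trans)
    show thesis
    proof (rule that[of a "cmod (a z)" "cmod (a s) / cmod (a z)"])
      show "cmod (a s) / cmod (a z) < 1"
        using \<open>cmod (a s) < cmod (a z)\<close> \<open>0 < cmod (a z)\<close> by simp
    qed (use a s z \<open>0 < cmod (a z)\<close> in auto)
  qed
qed

text \<open>If some \<open>a\<close> with maximum modulus \<open>M\<close> were uniformly smaller on
  \<open>S - V\<close>, a product \<open>a^n f\<close> with \<open>f\<close> in \<open>F\<close>
  would stay below \<open>M^n\<close> on \<open>S\<close>: on \<open>V\<close> because
  \<open>f\<close> has modulus below 1, off \<open>V\<close> because \<open>q^n\<close> beats the
  bound of \<open>f\<close>. Yet it reaches \<open>M^n\<close> at a point of \<open>T\<close>, since
  \<open>V\<close> misses \<open>T\<close>.\<close>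

lemma closed_boundary_Diff:
  assumes S: "closed_boundary Y B S" and T: "closed_boundary Y B T"
    and F: "finite F" "F \<subseteq> B"
    and V: "V = {y \<in> topspace Y. \<forall>f\<in>F. cmod (f y) < 1}" "V \<inter> T = {}"
  shows "closed_boundary Y B (S - V)"
proof (rule ccontr)
  assume not: "\<not> closed_boundary Y B (S - V)"
  have "openin Y V"
    unfolding V using F cont by (intro openin_norm_less_one) auto
  then have "closedin Y (S - V)"
    using S unfolding closed_boundary_def by (auto intro: closedin_diff)
  from not_closed_boundaryE[OF not this] obtain a M q where a: "a \<in> B" "0 < M" "0 \<le> q" "q < 1"
    "\<And>y. y \<in> topspace Y \<Longrightarrow> cmod (a y) \<le> M"
    "\<And>s. s \<in> S - V \<Longrightarrow> cmod (a s) \<le> q * M"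
    and "\<exists>y\<in>topspace Y. cmod (a y) = M"
    by metis
  then obtain t where t: "t \<in> T" "M \<le> cmod (a t)"
    using T unfolding closed_boundary_def by metis
  have ST: "S \<subseteq> topspace Y" "T \<subseteq> topspace Y"
    using S T unfolding closed_boundary_def by (auto dest: closedin_subset)
  then have "t \<in> topspace Y" "t \<notin> V"
    using t V by auto
  then obtain f where f: "f \<in> F" "1 \<le> cmod (f t)"
    unfolding V by (auto simp: not_less)
  have fB: "f \<in> B" using f F by auto
  obtain C where C: "1 \<le> C" "\<And>y. y \<in> topspace Y \<Longrightarrow> cmod (f y) \<le> C"
  proof (rule compact_space_bounded_family[OF compact, of "{f}"])
    show "continuous_map Y euclidean h" if "h \<in> {f}" for h
      using that cont[OF fB] by simp
  qed auto
  obtain n where n: "q ^ n < 1 / C"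
    using real_arch_pow_inv[of "1 / C" q] C a by auto
  define g where "g = (\<lambda>y\<in>topspace Y. (\<lambda>y\<in>topspace Y. a y ^ n) y * f y)"
  have "g \<in> B"
    unfolding g_def by (intro mult power a fB)
  have "cmod (g s) < M ^ n" if "s \<in> S" for s
  proof (cases "s \<in> V")
    case True
    then have "cmod (f s) < 1" "s \<in> topspace Y"
      using f V by auto
    have "cmod (a s) ^ n \<le> M ^ n"
      using a(5)[OF \<open>s \<in> topspace Y\<close>] by (intro power_mono) auto
    then have "cmod (a s) ^ n * cmod (f s) \<le> M ^ n * cmod (f s)"
      by (intro mult_right_mono) auto
    also have "\<dots> < M ^ n * 1"
      using a(2) \<open>cmod (f s) < 1\<close> by (intro mult_strict_left_mono) auto
    finally have "cmod (a s) ^ n * cmod (f s) < M ^ n"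
      by simp
    then show ?thesis
      using \<open>s \<in> topspace Y\<close> by (simp add: g_def norm_mult norm_power)
  next
    case False
    have sY: "s \<in> topspace Y" using that ST by auto
    have "cmod (a s) ^ n \<le> (q * M) ^ n"
      using a(6)[of s] False that by (intro power_mono) auto
    then have "cmod (a s) ^ n * cmod (f s) \<le> (q * M) ^ n * C"
      using C(2)[OF sY] a by (intro mult_mono) auto
    also have "\<dots> = (q ^ n * C) * M ^ n"
      by (simp add: power_mult_distrib)
    also have "\<dots> < 1 * M ^ n"
      using n C a by (intro mult_strict_right_mono) (auto simp: field_simps)
    finally show ?thesis
      using sY by (simp add: g_def norm_mult norm_power)
  qed
  moreover have "\<exists>s\<in>S. cmod (g t) \<le> cmod (g s)"
    using S \<open>g \<in> B\<close> t ST unfolding closed_boundary_def by blast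
  moreover have "M ^ n * 1 \<le> cmod (a t) ^ n * cmod (f t)"
    using t f a by (intro mult_mono power_mono) auto
  then have "M ^ n \<le> cmod (g t)"
    using t ST by (auto simp: g_def norm_mult norm_power)
  ultimately show False
    by force
qed

end

section \<open>Existence of the Shilov boundary\<close>

sublocale uniform_algebra \<subseteq> function_algebra X A
proof
  have "A \<subseteq> mspace (CC X)"
    using closedin_subset[OF closed] by simp
  then show "b \<in> extensional (topspace X)" "continuous_map X euclidean b" if "b \<in> A" for b
    using that mspace_cfunspace_compact[OF compact, where 'b = complex] by blast+
qed (use compact const add mult in auto)

context uniform_algebra
begin

text \<open>\<open>T\<close> is compact, so finitely many functions of \<open>A\<close> that vanish
  at \<open>x\<close> suffice to keep all of \<open>T\<close> outside the neighbourhood of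
  \<open>x\<close> which they define.\<close>

lemma separating_neighbourhood:
  assumes T: "closedin X T" and x: "x \<in> topspace X - T"
  obtains F where "finite F" "F \<subseteq> A" "\<forall>f\<in>F. cmod (f x) < 1" "\<forall>t\<in>T. \<exists>f\<in>F. 1 \<le> cmod (f t)"
proof -
  \<comment> \<open>The value 2, rather than 1, gives modulus above 1 on an open neighbourhood of
    \<open>t\<close>, as the covering argument requires.\<close>
  have "\<exists>f\<in>A. f x = 0 \<and> f t = 2" if t: "t \<in> T" for t
  proof -
    have tX: "t \<in> topspace X" using t T closedin_subset by blast
    then obtain a where a: "a \<in> A" "a x \<noteq> a t"
      using separates[of x t] x t by (metis DiffE)
    define f where "f = (\<lambda>y\<in>topspace X. 2 / (a t - a x) * (\<lambda>y\<in>topspace X. a y + (\<lambda>y\<in>topspace X. - a x) y) y)"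
    have "f \<in> A"
      unfolding f_def by (intro scale add a const)
    moreover have "f x = 0" "f t = 2"
      using a x tX by (auto simp: f_def divide_simps)
    ultimately show ?thesis by blast
  qed
  then obtain f where f: "\<And>t. t \<in> T \<Longrightarrow> f t \<in> A \<and> f t x = 0 \<and> f t t = 2"
    by metis
  define W where "W t = {y \<in> topspace X. 1 < cmod (f t y)}" for t
  have op: "openin X (W t)" if "t \<in> T" for t
    using openin_continuous_map_preimage[of X euclideanreal "\<lambda>y. cmod (f t y)" "{1<..}"]
      cont f[OF that] unfolding W_def by (simp add: continuous_map_norm)
  have "T \<subseteq> \<Union> (W ` T)"
    using f T closedin_subset unfolding W_def by fastforce
  then obtain \<F> where \<F>: "finite \<F>" "\<F> \<subseteq> W ` T" "T \<subseteq> \<Union>\<F>"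
    using compactinD[OF closedin_compact_space[OF compact T], of "W ` T"] op by blast
  then obtain T0 where T0: "finite T0" "T0 \<subseteq> T" "\<F> = W ` T0"
    by (meson finite_subset_image)
  show thesis
  proof (rule that[of "f ` T0"])
    show "\<forall>t\<in>T. \<exists>g\<in>f ` T0. 1 \<le> cmod (g t)"
    proof
      fix t
      assume "t \<in> T"
      then obtain s where "s \<in> T0" "t \<in> W s"
        using \<F> T0 by blast
      then show "\<exists>g\<in>f ` T0. 1 \<le> cmod (g t)"
        unfolding W_def by (auto intro: less_imp_le)
    qed
    show "f ` T0 \<subseteq> A" "\<forall>g\<in>f ` T0. cmod (g x) < 1"
      using f T0 by auto
  qed (use T0 in auto)
qed

text \<open>Shilov's theorem. A function whose peak set misses the intersection of all closed boundaries
  would have its peak set covered by finitely many of the neighbourhoods that may be removed from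
  a closed boundary.\<close>

lemma closed_boundary_Inter: "closed_boundary X A (\<Inter>{S. closed_boundary X A S})"
  unfolding closed_boundary_def[of X A "\<Inter>_"]
proof (intro conjI ballI)
  let ?S = "\<Inter>{S. closed_boundary X A S}"
  show "closedin X ?S"
    using closed_boundary_topspace by (intro closedin_Inter) (auto simp: closed_boundary_def)
  fix a x
  assume a: "a \<in> A" and x: "x \<in> topspace X"
  have ca: "continuous_map X euclidean (\<lambda>y. cmod (a y))"
    using cont[OF a] by (rule continuous_map_norm)
  obtain z where z: "z \<in> topspace X" "\<And>t. t \<in> topspace X \<Longrightarrow> cmod (a t) \<le> cmod (a z)"
    using compactin_attains_sup[of X "topspace X", OF _ _ ca] compact x
    unfolding compact_space_def by blast
  \<comment> \<open>The peak set of \<open>a\<close>, written as the preimage of a closed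
    half-line.\<close>
  define P where "P = {p \<in> topspace X. cmod (a p) \<in> {cmod (a z)..}}"
  have "P \<inter> ?S \<noteq> {}"
  proof
    assume disj: "P \<inter> ?S = {}"
    have "closedin X P"
      unfolding P_def by (intro closedin_continuous_map_preimage[OF ca]) simp
    then have P: "compactin X P"
      using compact by (rule closedin_compact_space[rotated])
    have "\<exists>F T. finite F \<and> F \<subseteq> A \<and> closed_boundary X A T \<and>
        (\<forall>f\<in>F. cmod (f p) < 1) \<and> (\<forall>t\<in>T. \<exists>f\<in>F. 1 \<le> cmod (f t))" if p: "p \<in> P" for p
    proof -
      obtain T where "closed_boundary X A T" "p \<notin> T"
        using disj p by blast
      moreover from this have "closedin X T" "p \<in> topspace X - T"
        using p unfolding closed_boundary_def P_def by auto
      ultimately show ?thesis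
        using separating_neighbourhood by metis
    qed
    then obtain F T where FT: "\<And>p. p \<in> P \<Longrightarrow> finite (F p) \<and> F p \<subseteq> A \<and> closed_boundary X A (T p) \<and>
        (\<forall>f\<in>F p. cmod (f p) < 1) \<and> (\<forall>t\<in>T p. \<exists>f\<in>F p. 1 \<le> cmod (f t))"
      by metis
    define V where "V p = {y \<in> topspace X. \<forall>f\<in>F p. cmod (f y) < 1}" for p
    have op: "openin X (V p)" if "p \<in> P" for p
      unfolding V_def using FT[OF that] cont by (intro openin_norm_less_one) auto
    have "P \<subseteq> \<Union> (V ` P)"
      using FT unfolding V_def P_def by fastforce
    then obtain \<F> where \<F>: "finite \<F>" "\<F> \<subseteq> V ` P" "P \<subseteq> \<Union>\<F>"
      using compactinD[OF P, of "V ` P"] op by blast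
    then obtain P0 where P0: "finite P0" "P0 \<subseteq> P" "\<F> = V ` P0"
      by (meson finite_subset_image)
    \<comment> \<open>Starting from the whole space, the sets \<open>V p\<close> are removed one at
      a time; each misses the closed boundary \<open>T p\<close>.\<close>
    have "closed_boundary X A (topspace X - \<Union> (V ` P0))"
      using P0(1,2)
    proof (induction P0 rule: finite_induct)
      case empty
      then show ?case using closed_boundary_topspace by simp
    next
      case (insert p P0)
      then have p: "p \<in> P" and IH: "closed_boundary X A (topspace X - \<Union> (V ` P0))"
        by auto
      have "V p \<inter> T p = {}"
        unfolding V_def using FT[OF p] by (auto simp: not_less[symmetric])
      then have "closed_boundary X A ((topspace X - \<Union> (V ` P0)) - V p)"
        using FT[OF p] by (intro closed_boundary_Diff[OF IH, of "T p" "F p"]) (auto simp: V_def)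
      moreover have "topspace X - \<Union> (V ` P0) - V p = topspace X - \<Union> (V ` insert p P0)"
        by auto
      ultimately show ?case
        by simp
    qed
    \<comment> \<open>What is left is a closed boundary, hence contains a peak point of
      \<open>a\<close>, although all of \<open>P\<close> has been removed.\<close>
    then obtain s where "s \<in> topspace X - \<Union> (V ` P0)" "cmod (a z) \<le> cmod (a s)"
      using a z unfolding closed_boundary_def by blast
    then show False
      using \<F> P0 unfolding P_def by auto
  qed
  then obtain s where "s \<in> ?S" "cmod (a z) \<le> cmod (a s)"
    unfolding P_def by blast
  then show "\<exists>s\<in>?S. cmod (a x) \<le> cmod (a s)"
    using order_trans[OF z(2)[OF x]] by blast
qed

lemma shilov_boundary_eq: "shilov_boundary X A = \<Inter>{S. closed_boundary X A S}"
  unfolding shilov_boundary_def by (rule Least_equality) (use closed_boundary_Inter in auto)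

end

section \<open>Passage to the Shilov boundary\<close>

text \<open>An intrinsic description of an algebra living on its Shilov boundary, without reference
  to an ambient space.\<close>

locale boundary_algebra = function_algebra +
  assumes minimal: "closed_boundary Y B S \<Longrightarrow> S = topspace Y"

text \<open>Maxima over \<open>X\<close> are attained on the Shilov boundary, so a closed boundary
  of the restricted algebra is one of \<open>A\<close> on \<open>X\<close> and contains the Shilov
  boundary by leastness.\<close>

lemma (in uniform_algebra) boundary_algebra_shilov:
  assumes \<Omega>: "\<Omega> = subtopology X (shilov_boundary X A)"
  shows "boundary_algebra \<Omega> (restrict_algebra A \<Omega>)"
proof -
  let ?S = "shilov_boundary X A"
  have S: "closed_boundary X A ?S"
    using closed_boundary_Inter shilov_boundary_eq by simp
  then have closed: "closedin X ?S" and SX: "?S \<subseteq> topspace X"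
    unfolding closed_boundary_def using closedin_subset by auto
  have top: "topspace \<Omega> = ?S"
    using SX \<Omega> by auto
  \<comment> \<open>The operations are pointwise, so the closure properties of \<open>A\<close>
    descend to restrictions; each one below is an instance.\<close>
  have restr: "(\<lambda>y\<in>topspace \<Omega>. g y) \<in> restrict_algebra A \<Omega>"
    if "(\<lambda>x\<in>topspace X. h x) \<in> A" "\<And>y. y \<in> ?S \<Longrightarrow> g y = h y" for g h
    unfolding restrict_algebra_def
  proof (rule image_eqI[OF _ that(1)])
    show "(\<lambda>y\<in>topspace \<Omega>. g y) = restrict (\<lambda>x\<in>topspace X. h x) (topspace \<Omega>)"
      using that(2) SX top by (auto simp: restrict_def fun_eq_iff)
  qed
  show ?thesis
  proof unfold_locales
    show "compact_space \<Omega>"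
      unfolding \<Omega> by (intro compact_space_subtopology closedin_compact_space compact closed)
    show "b \<in> extensional (topspace \<Omega>)" if "b \<in> restrict_algebra A \<Omega>" for b
      using that unfolding restrict_algebra_def by auto
    show "continuous_map \<Omega> euclidean b" if b: "b \<in> restrict_algebra A \<Omega>" for b
    proof -
      obtain a where "a \<in> A" "b = restrict a (topspace \<Omega>)"
        using b unfolding restrict_algebra_def by auto
      moreover from this have "continuous_map \<Omega> euclidean a"
        unfolding \<Omega> by (intro continuous_map_from_subtopology cont)
      ultimately show ?thesis
        by (simp add: continuous_map_restrict_topspace_iff)
    qed
    show "(\<lambda>y\<in>topspace \<Omega>. c) \<in> restrict_algebra A \<Omega>" for c
      by (rule restr[OF const]) simp
    fix b b'
    assume "b \<in> restrict_algebra A \<Omega>" "b' \<in> restrict_algebra A \<Omega>"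
    then obtain a a' where a: "a \<in> A" "b = restrict a (topspace \<Omega>)"
      and a': "a' \<in> A" "b' = restrict a' (topspace \<Omega>)"
      unfolding restrict_algebra_def by auto
    show "(\<lambda>y\<in>topspace \<Omega>. b y + b' y) \<in> restrict_algebra A \<Omega>"
      by (rule restr[OF add[OF a(1) a'(1)]]) (simp add: a a' top)
    show "(\<lambda>y\<in>topspace \<Omega>. b y * b' y) \<in> restrict_algebra A \<Omega>"
      by (rule restr[OF mult[OF a(1) a'(1)]]) (simp add: a a' top)
  next
    fix T
    assume T: "closed_boundary \<Omega> (restrict_algebra A \<Omega>) T"
    then have "closedin X T" and TS: "T \<subseteq> ?S"
      using closedin_trans_full[OF _ closed] closedin_subset top
      unfolding closed_boundary_def \<Omega> by blast+
    have "closed_boundary X A T"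
      unfolding closed_boundary_def
    proof (intro conjI ballI)
      fix a x
      assume a: "a \<in> A" and "x \<in> topspace X"
      then obtain s where s: "s \<in> ?S" "cmod (a x) \<le> cmod (a s)"
        using S unfolding closed_boundary_def by blast
      have "restrict a (topspace \<Omega>) \<in> restrict_algebra A \<Omega>"
        using a unfolding restrict_algebra_def by auto
      then obtain t where "t \<in> T" "cmod (restrict a (topspace \<Omega>) s) \<le> cmod (restrict a (topspace \<Omega>) t)"
        using T s top unfolding closed_boundary_def by blast
      moreover from this have "t \<in> topspace \<Omega>" "s \<in> topspace \<Omega>"
        using TS s top by auto
      ultimately show "\<exists>t\<in>T. cmod (a x) \<le> cmod (a t)"
        using s(2) by (intro bexI[of _ t]) auto
    qed fact
    then show "T = topspace \<Omega>"
      using TS top shilov_boundary_eq by blast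
  qed
qed

section \<open>Weighted peak functions\<close>

context boundary_algebra
begin

text \<open>By minimality the complement of \<open>V\<close> is no closed boundary, so some
  \<open>a\<close> is smaller there by a factor \<open>q\<close>. A high power of \<open>a\<close>
  outweighs the variation of \<open>f\<close>, which is bounded on a compact space; dividing by the
  maximum of the weighted modulus gives \<open>b\<close>.\<close>

lemma weighted_peak:
  fixes f :: "'a \<Rightarrow> real"
  assumes f: "continuous_map Y euclidean f" "\<And>y. y \<in> topspace Y \<Longrightarrow> 0 < f y"
    and V: "openin Y V" "x \<in> V" and \<epsilon>: "0 < \<epsilon>"
  obtains b z where "b \<in> B" "z \<in> V" "cmod (b z) * f z = 1"
    "\<And>y. y \<in> topspace Y \<Longrightarrow> cmod (b y) * f y \<le> 1"
    "\<And>y. y \<in> topspace Y - V \<Longrightarrow> cmod (b y) * f y \<le> \<epsilon>"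
proof -
  have VY: "V \<subseteq> topspace Y"
    using V openin_subset by auto
  have "\<not> closed_boundary Y B (topspace Y - V)"
    using minimal[of "topspace Y - V"] V VY by auto
  moreover have "closedin Y (topspace Y - V)"
    using V by blast
  ultimately obtain a M q where a: "a \<in> B" "0 < M" "0 \<le> q" "q < 1"
    "\<And>y. y \<in> topspace Y - V \<Longrightarrow> cmod (a y) \<le> q * M"
    and "\<exists>y\<in>topspace Y. cmod (a y) = M"
    using not_closed_boundaryE by metis
  then obtain p where p: "p \<in> topspace Y" "cmod (a p) = M"
    by auto
  have Y: "compactin Y (topspace Y)" "topspace Y \<noteq> {}"
    using compact p unfolding compact_space_def by auto
  obtain t where t: "t \<in> topspace Y" "\<And>y. y \<in> topspace Y \<Longrightarrow> f y \<le> f t"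
    using compactin_attains_sup[OF Y f(1)] by blast
  define C where "C = f t"
  have C: "0 < C" "\<And>y. y \<in> topspace Y \<Longrightarrow> f y \<le> C"
    using t f unfolding C_def by auto
  \<comment> \<open>\<open>q^n\<close> must compensate the ratio of \<open>C\<close> to the weight
    at \<open>p\<close>. The cap 1/2 keeps the weighted maximum inside \<open>V\<close> even when
    \<epsilon> \<ge> 1.\<close>
  obtain n where n: "q ^ n < min \<epsilon> (1/2) * f p / C"
    using real_arch_pow_inv[of "min \<epsilon> (1/2) * f p / C" q] C f(2)[OF p(1)] a \<epsilon> by auto
  define g where "g y = cmod (a y) ^ n * f y" for y
  have "continuous_map Y euclidean g"
    unfolding g_def by (intro continuous_intros cont a f)
  then obtain z where z: "z \<in> topspace Y" "\<And>y. y \<in> topspace Y \<Longrightarrow> g y \<le> g z"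
    using compactin_attains_sup[OF Y] by blast
  have gp: "g p = M ^ n * f p" "0 < M ^ n * f p" "g p \<le> g z"
    unfolding g_def using p f(2)[OF p(1)] a(2) z by (auto simp: g_def[symmetric])
  then have gz: "0 < g z" "M ^ n * f p \<le> g z"
    by auto
  have off: "g y \<le> min \<epsilon> (1/2) * g z" if y: "y \<in> topspace Y - V" for y
  proof -
    have "g y \<le> (q * M) ^ n * C"
      unfolding g_def using a y C(1) C(2)[of y] f(2)[of y] by (intro mult_mono power_mono) auto
    also have "\<dots> = q ^ n * C * M ^ n"
      by (simp add: power_mult_distrib)
    also have "\<dots> \<le> min \<epsilon> (1/2) * f p * M ^ n"
      using n C a by (intro mult_right_mono) (auto simp: field_simps)
    also have "\<dots> \<le> min \<epsilon> (1/2) * g z"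
      using mult_left_mono[OF gz(2), of "min \<epsilon> (1/2)"] \<epsilon> by (simp add: algebra_simps)
    finally show ?thesis .
  qed
  define b where "b = (\<lambda>y\<in>topspace Y. complex_of_real (1 / g z) * (\<lambda>y\<in>topspace Y. a y ^ n) y)"
  have b: "cmod (b y) * f y = g y / g z" if "y \<in> topspace Y" for y
    using that gz(1) f(2)[OF z(1)] unfolding b_def g_def by (simp add: norm_mult norm_divide norm_power)
  show thesis
  proof (rule that)
    show "b \<in> B"
      unfolding b_def by (intro scale power a)
    show "z \<in> V"
    proof (rule ccontr)
      assume "z \<notin> V"
      then have "g z \<le> min \<epsilon> (1/2) * g z"
        using off z by auto
      also have "\<dots> \<le> 1/2 * g z"
        using gz by (intro mult_right_mono) auto
      finally show False
        using gz by simp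
    qed
    show "cmod (b z) * f z = 1"
      using b[OF z(1)] gz by simp
    show "cmod (b y) * f y \<le> 1" if "y \<in> topspace Y" for y
      using b[OF that] z(2)[OF that] gz by simp
    show "cmod (b y) * f y \<le> \<epsilon>" if y: "y \<in> topspace Y - V" for y
    proof -
      have "g y \<le> \<epsilon> * g z"
        using off[OF y] mult_right_mono[of "min \<epsilon> (1/2)" \<epsilon> "g z"] gz by linarith
      then show ?thesis
        using b[of y] y gz by (simp add: pos_divide_le_eq)
    qed
  qed
qed

text \<open>In the open set where \<open>g\<close> is smaller than \<open>f\<close>, a
  \<open>g\<close>-weighted peak function would lie in the unit ball for \<open>g\<close> but not in
  that for \<open>f\<close>. Used in both directions, this recovers a weight from its unit
  ball.\<close>

lemma weight_le_if_unit_balls_subset: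
  fixes f g :: "'a \<Rightarrow> real"
  assumes "continuous_map Y euclidean f" "continuous_map Y euclidean g"
    and g: "\<And>y. y \<in> topspace Y \<Longrightarrow> 0 < g y"
    and *: "\<And>b. \<lbrakk>b \<in> B; \<forall>y\<in>topspace Y. cmod (b y) * g y \<le> 1\<rbrakk>
      \<Longrightarrow> \<forall>y\<in>topspace Y. cmod (b y) * f y \<le> 1"
    and x: "x \<in> topspace Y"
  shows "f x \<le> g x"
proof (rule ccontr)
  assume "\<not> f x \<le> g x"
  define V where "V = {y \<in> topspace Y. g y - f y \<in> {..<0}}"
  have "openin Y V"
    unfolding V_def
    by (rule openin_continuous_map_preimage[OF continuous_map_diff[OF assms(2,1)]]) simp
  moreover have "x \<in> V"
    using x \<open>\<not> f x \<le> g x\<close> unfolding V_def by simp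
  ultimately obtain b z where b: "b \<in> B" "z \<in> V" "cmod (b z) * g z = 1"
    "\<And>y. y \<in> topspace Y \<Longrightarrow> cmod (b y) * g y \<le> 1"
    using weighted_peak[OF assms(2) g, of V x 1] by (metis zero_less_one)
  have z: "z \<in> topspace Y" "g z < f z"
    using b(2) unfolding V_def by auto
  have "cmod (b z) * f z \<le> cmod (b z) * g z"
    using *[OF b(1)] b z by auto
  moreover have "0 < cmod (b z)"
    using b(3) by (cases "b z = 0") auto
  ultimately show False
    using z by simp
qed

end

section \<open>The modules of multiples of a weight\<close>

context function_algebra
begin

lemma positive_functionsD:
  assumes "f \<in> positive_functions Y"
  shows "f \<in> extensional (topspace Y)" "continuous_map Y euclidean f"
    "y \<in> topspace Y \<Longrightarrow> 0 < f y"
  using assms mspace_cfunspace_compact[OF compact, where 'b = real]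
  unfolding positive_functions_def by blast+

lemma mult_moduleI: "b \<in> B \<Longrightarrow> (\<lambda>y\<in>topspace Y. b y * of_real (f y)) \<in> mult_module Y B f"
  unfolding mult_module_def by blast

lemma mult_moduleE:
  assumes "u \<in> mult_module Y B f"
  obtains b where "b \<in> B" "u = (\<lambda>y\<in>topspace Y. b y * of_real (f y))"
  using assms unfolding mult_module_def by blast

text \<open>Isometries starting from \<open>B\<close> thereby become a special case of isometries
  between modules.\<close>

lemma mult_module_one: "mult_module Y B (\<lambda>y\<in>topspace Y. 1) = B"
proof -
  have "(\<lambda>y\<in>topspace Y. b y * of_real ((\<lambda>y\<in>topspace Y. 1) y)) = b" if "b \<in> B" for b
    using ext[OF that] by (auto simp: fun_eq_iff extensional_def)
  then show ?thesis
    unfolding mult_module_def by simp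
qed

lemma mult_module_add:
  assumes "u \<in> mult_module Y B f" "v \<in> mult_module Y B f"
  shows "(\<lambda>y\<in>topspace Y. u y + v y) \<in> mult_module Y B f"
proof -
  obtain a b where a: "a \<in> B" "u = (\<lambda>y\<in>topspace Y. a y * of_real (f y))"
    and b: "b \<in> B" "v = (\<lambda>y\<in>topspace Y. b y * of_real (f y))"
    using assms by (metis mult_moduleE)
  have "(\<lambda>y\<in>topspace Y. u y + v y) =
      (\<lambda>y\<in>topspace Y. (\<lambda>y\<in>topspace Y. a y + b y) y * of_real (f y))"
    unfolding a(2) b(2) by (auto simp: algebra_simps)
  then show ?thesis
    using mult_moduleI[OF add[OF a(1) b(1)], of f] by simp
qed

lemma mult_module_mult:
  assumes "b \<in> B" "u \<in> mult_module Y B f"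
  shows "(\<lambda>y\<in>topspace Y. b y * u y) \<in> mult_module Y B f"
proof -
  obtain a where a: "a \<in> B" "u = (\<lambda>y\<in>topspace Y. a y * of_real (f y))"
    using assms by (metis mult_moduleE)
  have "(\<lambda>y\<in>topspace Y. b y * u y) =
      (\<lambda>y\<in>topspace Y. (\<lambda>y\<in>topspace Y. b y * a y) y * of_real (f y))"
    unfolding a(2) by (auto simp: algebra_simps)
  then show ?thesis
    using mult_moduleI[OF mult[OF assms(1) a(1)], of f] by simp
qed

lemma mult_module_scale:
  assumes "u \<in> mult_module Y B f"
  shows "(\<lambda>y\<in>topspace Y. c * u y) \<in> mult_module Y B f"
proof -
  have "(\<lambda>y\<in>topspace Y. c * u y) = (\<lambda>y\<in>topspace Y. (\<lambda>y\<in>topspace Y. c) y * u y)"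
    by auto
  then show ?thesis
    using mult_module_mult[OF const[of c] assms] by simp
qed

lemma mult_module_cont:
  assumes "f \<in> positive_functions Y" "u \<in> mult_module Y B f"
  shows "continuous_map Y euclidean u"
proof -
  obtain b where "b \<in> B" "u = (\<lambda>y\<in>topspace Y. b y * of_real (f y))"
    using assms by (metis mult_moduleE)
  then show ?thesis
    using positive_functionsD[OF assms(1)] cont
    by (auto simp: continuous_map_restrict_topspace_iff intro!: continuous_intros)
qed

lemma mult_module_ext: "u \<in> mult_module Y B f \<Longrightarrow> u \<in> extensional (topspace Y)"
  unfolding mult_module_def by auto

lemma mult_module_mspace:
  assumes "f \<in> positive_functions Y" "u \<in> mult_module Y B f"
  shows "u \<in> mspace (CC Y)"
  using mult_module_cont[OF assms] mult_module_ext[OF assms(2)]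
  by (subst mspace_cfunspace_compact[OF compact]) auto

text \<open>The norm is the distance to zero. Zero is written as a multiple of \<open>u\<close>, so
  that \<open>mult_module_scale\<close> and later \<open>T_scale\<close> apply to it.\<close>

lemma mult_module_norm_le_iff:
  assumes f: "f \<in> positive_functions Y" and u: "u \<in> mult_module Y B f" and "topspace Y \<noteq> {}"
  shows "mdist (CC Y) u (\<lambda>y\<in>topspace Y. 0 * u y) \<le> c \<longleftrightarrow> (\<forall>y\<in>topspace Y. cmod (u y) \<le> c)"
  using cfunspace_mdist_le[OF mult_module_mspace[OF f u]
      mult_module_mspace[OF f mult_module_scale[OF u, of 0]] assms(3), of c]
  by simp

end

section \<open>Isometries between weighted modules\<close>

locale mult_module_isometry = boundary_algebra +
  fixes f g and T
  assumes f: "f \<in> positive_functions Y" and g: "g \<in> positive_functions Y"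
    and isometry: "surjective_linear_isometry Y (mult_module Y B f) (mult_module Y B g) T"
begin

abbreviation "E \<equiv> mult_module Y B f"
abbreviation "F \<equiv> mult_module Y B g"

lemma T_in: "u \<in> E \<Longrightarrow> T u \<in> F"
  using isometry unfolding surjective_linear_isometry_def by blast

lemma surj: "v \<in> F \<Longrightarrow> \<exists>u\<in>E. T u = v"
  using conjunct1[OF isometry[unfolded surjective_linear_isometry_def]] by (metis imageE)

lemma T_add:
  "\<lbrakk>u \<in> E; v \<in> E\<rbrakk> \<Longrightarrow> T (\<lambda>y\<in>topspace Y. u y + v y) = (\<lambda>y\<in>topspace Y. T u y + T v y)"
  using isometry unfolding surjective_linear_isometry_def by simp

lemma T_scale: "u \<in> E \<Longrightarrow> T (\<lambda>y\<in>topspace Y. c * u y) = (\<lambda>y\<in>topspace Y. c * T u y)"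
  using isometry unfolding surjective_linear_isometry_def by simp

lemma T_mdist: "\<lbrakk>u \<in> E; v \<in> E\<rbrakk> \<Longrightarrow> mdist (CC Y) (T u) (T v) = mdist (CC Y) u v"
  using isometry unfolding surjective_linear_isometry_def by blast

text \<open>Distances to zero are preserved; in the form of pointwise bounds this also covers the
  empty space, where both sides hold vacuously.\<close>

lemma T_norm_le_iff:
  assumes u: "u \<in> E"
  shows "(\<forall>y\<in>topspace Y. cmod (T u y) \<le> c) \<longleftrightarrow> (\<forall>y\<in>topspace Y. cmod (u y) \<le> c)"
proof (cases "topspace Y = {}")
  case False
  then show ?thesis
    using mult_module_norm_le_iff[OF f u False] mult_module_norm_le_iff[OF g T_in[OF u] False]
      T_mdist[OF u mult_module_scale[OF u, of 0]] T_scale[OF u, of 0] by simp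
qed simp

text \<open>If \<open>T k\<close> peaks near \<open>x\<close> and \<open>k\<close> attains its norm at \<open>y\<close>, then adding to \<open>u\<close> a large
  multiple of \<open>k\<close>, rotated so that no cancellation occurs at \<open>y\<close>, compares \<open>u y\<close> with \<open>T u x\<close>.
  In the limit \<open>y\<close> is the point at which the adjoint of \<open>T\<close> sends the evaluation at \<open>x\<close>, up to a
  unimodular factor.\<close>

lemma approximate_evaluation:
  assumes x: "x \<in> topspace Y" and U: "finite U" "U \<subseteq> E" and \<delta>: "0 < \<delta>"
  obtains y where "y \<in> topspace Y" "\<And>u. u \<in> U \<Longrightarrow> cmod (u y) \<le> cmod (T u x) + \<delta>"
proof -
  have contT: "continuous_map Y euclidean (T u)" if "u \<in> U" for u
    using mult_module_cont[OF g T_in] that U by blast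
  \<comment> \<open>Near \<open>x\<close> each \<open>T u\<close> stays within \<delta> of
    \<open>T u x\<close>; dividing by \<delta> gives the form that
    \<open>openin_norm_less_one\<close> expects.\<close>
  define V where "V = {y \<in> topspace Y. \<forall>h\<in>(\<lambda>u y. of_real (1 / \<delta>) * (T u y - T u x)) ` U. cmod (h y) < 1}"
  have "openin Y V"
    unfolding V_def
  proof (rule openin_norm_less_one)
    show "continuous_map Y euclidean h" if "h \<in> (\<lambda>u y. of_real (1 / \<delta>) * (T u y - T u x)) ` U" for h
      using that contT by (elim imageE) (simp only:, intro continuous_intros, auto)
  qed (use U in auto)
  moreover have "x \<in> V"
    using x unfolding V_def by auto
  ultimately obtain b z where b: "b \<in> B" "z \<in> V" "cmod (b z) * g z = 1"
    "\<And>y. y \<in> topspace Y \<Longrightarrow> cmod (b y) * g y \<le> 1"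
    "\<And>y. y \<in> topspace Y - V \<Longrightarrow> cmod (b y) * g y \<le> 1 / 2"
    using weighted_peak[OF positive_functionsD(2,3)[OF g], of V x "1 / 2"] by (metis half_gt_zero zero_less_one)
  define e where "e = (\<lambda>y\<in>topspace Y. b y * complex_of_real (g y))"
  have e: "cmod (e y) = cmod (b y) * g y" if "y \<in> topspace Y" for y
    using that positive_functionsD(3)[OF g that] unfolding e_def by (simp add: norm_mult)
  obtain k where k: "k \<in> E" "T k = e"
    using surj[of e] mult_moduleI[OF b(1)] unfolding e_def by blast
  have zY: "z \<in> topspace Y"
    using b(2) unfolding V_def by auto
  have "compactin Y (topspace Y)" "topspace Y \<noteq> {}"
    using compact x unfolding compact_space_def by auto
  then obtain y where y: "y \<in> topspace Y" "\<And>t. t \<in> topspace Y \<Longrightarrow> cmod (k t) \<le> cmod (k y)"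
    using compactin_attains_sup continuous_map_norm[OF mult_module_cont[OF f k(1)]] by blast
  have "cmod (k y) \<le> 1"
    using T_norm_le_iff[OF k(1), of 1] e b(4) k(2) y(1) by simp
  moreover have "cmod (e z) \<le> cmod (k y)"
    using T_norm_le_iff[OF k(1), of "cmod (k y)"] y(2) k(2) zY by simp
  \<comment> \<open>The image \<open>T k = e\<close> has maximum modulus 1, hence so has
    \<open>k\<close>.\<close>
  ultimately have ky: "cmod (k y) = 1"
    using e[OF zY] b(3) by simp
  \<comment> \<open>Off \<open>V\<close>, where \<open>e\<close> has modulus at most 1/2, the
    multiple \<open>2 * C\<close> of \<open>e\<close> adds at most \<open>C\<close> and
    \<open>T u\<close> another \<open>C\<close>, so the total is at most
    \<open>2 * C\<close>.\<close>
  obtain C where C: "1 \<le> C" "\<And>h t. h \<in> T ` U \<Longrightarrow> t \<in> topspace Y \<Longrightarrow> cmod (h t) \<le> C"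
    by (rule compact_space_bounded_family[OF compact, of "T ` U"]) (use U contT in auto)
  show thesis
  proof (rule that[OF y(1)])
    fix u
    assume u: "u \<in> U"
    \<comment> \<open>The unimodular factor turns \<open>k y\<close> into the direction of
      \<open>u y\<close>, so that moduli add at \<open>y\<close>; for \<open>u y = 0\<close> any
      such factor will do.\<close>
    define \<phi> where "\<phi> = (if u y = 0 then 1 else sgn (u y) / k y)"
    have \<phi>: "cmod \<phi> = 1"
      using ky by (auto simp: \<phi>_def norm_divide norm_sgn)
    have "u y + of_real (2 * C) * \<phi> * k y =
        (if u y = 0 then of_real (2 * C) * k y else of_real (cmod (u y) + 2 * C) * sgn (u y))"
      using ky by (auto simp: \<phi>_def sgn_eq field_simps)
    then have aligned: "cmod (u y + of_real (2 * C) * \<phi> * k y) = cmod (u y) + 2 * C"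
      using ky C(1) by (auto simp: norm_mult norm_sgn simp del: of_real_add of_real_mult)
    define v where "v = (\<lambda>t\<in>topspace Y. of_real (2 * C) * \<phi> * k t)"
    have v: "v \<in> E" "T v = (\<lambda>t\<in>topspace Y. of_real (2 * C) * \<phi> * e t)"
      unfolding v_def using mult_module_scale[OF k(1)] T_scale[OF k(1)] k(2) by auto
    define w where "w = (\<lambda>t\<in>topspace Y. u t + v t)"
    have uE: "u \<in> E" using u U by auto
    have w: "w \<in> E" "T w = (\<lambda>t\<in>topspace Y. T u t + T v t)"
      unfolding w_def using mult_module_add[OF uE v(1)] T_add[OF uE v(1)] by auto
    have "cmod (T w t) \<le> cmod (T u x) + \<delta> + 2 * C" if t: "t \<in> topspace Y" for t
    proof -
      have Tw: "cmod (T w t) \<le> cmod (T u t) + 2 * C * (cmod (b t) * g t)"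
        using t C(1) norm_triangle_ineq[of "T u t" "of_real (2 * C) * \<phi> * e t"] \<phi> e[OF t]
        by (simp add: w v norm_mult)
      show ?thesis
      proof (cases "t \<in> V")
        case True
        then have "cmod (of_real (1 / \<delta>) * (T u t - T u x)) < 1"
          using u unfolding V_def by auto
        then have "cmod (T u t - T u x) < \<delta>"
          using \<delta> by (simp add: norm_mult norm_divide)
        then have "cmod (T u t) \<le> cmod (T u x) + \<delta>"
          using norm_triangle_sub[of "T u t" "T u x"] by simp
        moreover have "2 * C * (cmod (b t) * g t) \<le> 2 * C * 1"
          using b(4)[OF t] C(1) by (intro mult_left_mono) auto
        ultimately show ?thesis
          using Tw by simp
      next
        case False
        then have "2 * C * (cmod (b t) * g t) \<le> 2 * C * (1 / 2)"
          using b(5)[of t] t C(1) by (intro mult_left_mono) auto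
        moreover have "cmod (T u t) \<le> C"
          using C(2) u t by auto
        ultimately show ?thesis
          using Tw \<delta> norm_ge_zero[of "T u x"] by linarith
      qed
    qed
    then have "cmod (w y) \<le> cmod (T u x) + \<delta> + 2 * C"
      using T_norm_le_iff[OF w(1)] y(1) by blast
    then show "cmod (u y) \<le> cmod (T u x) + \<delta>"
      using aligned y(1) unfolding w_def v_def by simp
  qed
qed

end

section \<open>Linear isometries defined on the algebra\<close>

locale algebra_isometry = mult_module_isometry Y B "\<lambda>y\<in>topspace Y. 1" g T
  for Y :: "'x topology" and B g T
begin

abbreviation "one \<equiv> (\<lambda>y\<in>topspace Y. 1 :: complex)"

text \<open>The lower bound holds because \<open>one\<close> has modulus 1 at whatever point
  approximates the evaluation of \<open>T\<close> at \<open>x\<close>.\<close>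

lemma cmod_T_one:
  assumes x: "x \<in> topspace Y"
  shows "cmod (T one x) = 1"
proof (rule antisym)
  have one: "one \<in> E"
    using const[of 1] mult_module_one by simp
  show "cmod (T one x) \<le> 1"
    using T_norm_le_iff[OF one, of 1] x by simp
  show "1 \<le> cmod (T one x)"
  proof (rule field_le_epsilon)
    fix \<delta> :: real
    assume \<delta>: "0 < \<delta>"
    obtain y where "y \<in> topspace Y" "\<And>u. u \<in> {one} \<Longrightarrow> cmod (u y) \<le> cmod (T u x) + \<delta>"
      by (rule approximate_evaluation[of x "{one}" \<delta>]) (use one x \<delta> in auto)
    then show "1 \<le> cmod (T one x) + \<delta>"
      by force
  qed
qed

text \<open>After division by \<open>T one x\<close>, the functional
  \<open>h \<mapsto> T h x\<close> is approximated on the three functions involved by evaluation at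
  a single point, and evaluations are multiplicative.\<close>

lemma T_mult:
  assumes a: "a \<in> B" and b: "b \<in> B" and x: "x \<in> topspace Y"
  shows "T a x * T b x = T one x * T (\<lambda>y\<in>topspace Y. a y * b y) x"
proof -
  define c where "c = (\<lambda>y\<in>topspace Y. a y * b y)"
  have c: "c \<in> B"
    unfolding c_def using a b by (rule mult)
  have one: "one \<in> E"
    using const[of 1] mult_module_one by simp
  have w: "T one x \<noteq> 0"
    using cmod_T_one[OF x] by auto
  define \<mu> where "\<mu> h = T h x / T one x" for h
  \<comment> \<open>Subtracting the constant \<open>\<mu> h\<close> leaves a function whose image
    vanishes at \<open>x\<close>; \<open>approximate_evaluation\<close> then makes the three such
    functions small at one common \<open>y\<close>.\<close>
  define d where "d h = (\<lambda>y\<in>topspace Y. h y + (\<lambda>y\<in>topspace Y. - \<mu> h * one y) y)" for h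
  have d: "d h \<in> E" "T (d h) x = 0" if "h \<in> B" for h
  proof -
    have h: "h \<in> E"
      using that mult_module_one by simp
    show "d h \<in> E"
      unfolding d_def by (intro mult_module_add mult_module_scale h one)
    show "T (d h) x = 0"
      unfolding d_def T_add[OF h mult_module_scale[OF one]] T_scale[OF one]
      using x w by (simp add: \<mu>_def)
  qed
  \<comment> \<open>The coefficient of \<delta> in the final estimate: one from \<open>c\<close>,
    one from the product of two errors (as \<delta> \<le> 1), the rest from the mixed terms.\<close>
  define K where "K = 2 + cmod (\<mu> a) + cmod (\<mu> b)"
  have K: "0 < K"
    unfolding K_def by (simp add: add_pos_nonneg)
  have "cmod (\<mu> a * \<mu> b - \<mu> c) \<le> 0 + \<epsilon>" if \<epsilon>: "0 < \<epsilon>" for \<epsilon>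
  proof -
    define \<delta> where "\<delta> = min 1 (\<epsilon> / K)"
    have \<delta>: "0 < \<delta>" "\<delta> \<le> 1" "\<delta> * K \<le> \<epsilon>"
      using \<epsilon> K by (auto simp: \<delta>_def min_def field_simps)
    obtain y where y: "y \<in> topspace Y" "\<And>u. u \<in> {d a, d b, d c} \<Longrightarrow> cmod (u y) \<le> cmod (T u x) + \<delta>"
      by (rule approximate_evaluation[of x "{d a, d b, d c}" \<delta>]) (use d a b c x \<delta> in auto)
    have near: "cmod (a y - \<mu> a) \<le> \<delta>" "cmod (b y - \<mu> b) \<le> \<delta>" "cmod (c y - \<mu> c) \<le> \<delta>"
      using y(2)[of "d a"] y(2)[of "d b"] y(2)[of "d c"] d(2) a b c y(1) by (auto simp: d_def)
    have prods: "cmod ((a y - \<mu> a) * (b y - \<mu> b)) \<le> \<delta> * 1"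
      "cmod (\<mu> a * (b y - \<mu> b)) \<le> cmod (\<mu> a) * \<delta>"
      "cmod (\<mu> b * (a y - \<mu> a)) \<le> cmod (\<mu> b) * \<delta>"
      unfolding norm_mult using near \<delta> by (auto intro!: mult_mono mult_left_mono simp del: mult_1_right)
    \<comment> \<open>The product \<open>c y\<close> is expanded around \<open>\<mu> a\<close> and
      \<open>\<mu> b\<close>, which leaves only small terms.\<close>
    have "\<mu> a * \<mu> b - \<mu> c = (c y - \<mu> c) -
        ((a y - \<mu> a) * (b y - \<mu> b) + (\<mu> a * (b y - \<mu> b) + \<mu> b * (a y - \<mu> a)))"
      using y(1) by (simp add: c_def algebra_simps)
    also have "cmod \<dots> \<le> cmod (c y - \<mu> c) + (cmod ((a y - \<mu> a) * (b y - \<mu> b)) +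
        (cmod (\<mu> a * (b y - \<mu> b)) + cmod (\<mu> b * (a y - \<mu> a))))"
      by (intro order_trans[OF norm_triangle_ineq4] order_trans[OF norm_triangle_ineq]
          add_mono norm_triangle_ineq order_refl)
    also have "\<dots> \<le> \<delta> + (\<delta> * 1 + (cmod (\<mu> a) * \<delta> + cmod (\<mu> b) * \<delta>))"
      using near(3) prods by (intro add_mono)
    also have "\<dots> = \<delta> * K"
      by (simp add: K_def algebra_simps)
    finally show ?thesis
      using \<delta> by simp
  qed
  then have "cmod (\<mu> a * \<mu> b - \<mu> c) \<le> 0"
    by (rule field_le_epsilon)
  then show ?thesis
    using w by (simp add: \<mu>_def c_def field_simps)
qed

text \<open>Applied to the preimage \<open>b\<close> of \<open>g\<close>, multiplicativity reads \<open>g\<^sup>2 = (h g) (k g)\<close> with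
  \<open>T 1 = h g\<close> and \<open>T (b\<^sup>2) = k g\<close>, so \<open>h\<close> and \<open>k\<close> are inverse to each other.\<close>

lemma weight_in_Q: "g \<in> Q Y B"
proof -
  have "(\<lambda>y\<in>topspace Y. one y * of_real (g y)) \<in> F"
    by (rule mult_moduleI[OF const])
  then obtain b where b: "b \<in> B" "T b = (\<lambda>y\<in>topspace Y. one y * of_real (g y))"
    using surj mult_module_one by metis
  obtain h where h: "h \<in> B" "T one = (\<lambda>y\<in>topspace Y. h y * of_real (g y))"
    using mult_moduleE T_in const[of 1] mult_module_one by metis
  obtain k where k: "k \<in> B" "T (\<lambda>y\<in>topspace Y. b y * b y) = (\<lambda>y\<in>topspace Y. k y * of_real (g y))"
    using mult_moduleE T_in mult[OF b(1) b(1)] mult_module_one by metis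
  have inv: "k y * h y = 1" if y: "y \<in> topspace Y" for y
    using T_mult[OF b(1) b(1) y] positive_functionsD(3)[OF g y] y by (simp add: b(2) h(2) k(2) mult.commute[of "k y"])
  have norm: "g y = cmod (k y)" if y: "y \<in> topspace Y" for y
  proof -
    \<comment> \<open>Unimodularity of \<open>T one\<close>; as \<open>k\<close> inverts
      \<open>h\<close>, the weight is the modulus of \<open>k\<close>.\<close>
    have "cmod (h y) * g y = 1"
      using cmod_T_one[OF y] positive_functionsD(3)[OF g y] y by (simp add: h(2) norm_mult)
    moreover have "cmod (k y) * cmod (h y) = 1"
      using inv[OF y] by (metis norm_mult norm_one)
    ultimately show ?thesis
      by (metis mult.assoc mult.left_neutral mult.right_neutral)
  qed
  have "k \<in> invertibles Y B"
    unfolding invertibles_def using inv h k by blast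
  moreover have "g = (\<lambda>y\<in>topspace Y. cmod (k y))"
    using positive_functionsD(1)[OF g] norm by (auto simp: fun_eq_iff extensional_def)
  ultimately show ?thesis
    unfolding Q_def by blast
qed

end

section \<open>The equivalences\<close>

context boundary_algebra
begin

lemma one_positive: "(\<lambda>y\<in>topspace Y. 1) \<in> positive_functions Y"
  using mspace_cfunspace_compact[OF compact, where 'b = real]
  unfolding positive_functions_def by (simp add: continuous_map_restrict_topspace_iff del: mspace_cfunspace)

lemma linearly_isometric_imp_Q:
  assumes "f \<in> positive_functions Y" "linearly_isometric Y B (mult_module Y B f)"
  shows "f \<in> Q Y B"
proof -
  obtain T where "surjective_linear_isometry Y B (mult_module Y B f) T"
    using assms(2) unfolding linearly_isometric_def by blast
  then interpret algebra_isometry Y B f T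
    by unfold_locales (use assms one_positive mult_module_one in auto)
  show ?thesis
    by (rule weight_in_Q)
qed

text \<open>A module map is determined by the image \<open>h g\<close> of the generator
  \<open>f\<close>, and \<open>h\<close> is invertible because \<open>g\<close> is attained too. The
  isometry then says that \<open>f\<close> and \<open>\<bar>h\<bar> g\<close> have the same unit
  ball, so these weights coincide.\<close>

lemma module_isometric_imp_quotient_in_Q:
  assumes f: "f \<in> positive_functions Y" and g: "g \<in> positive_functions Y"
    and iso: "module_isometric Y B (mult_module Y B f) (mult_module Y B g)"
  shows "(\<lambda>y\<in>topspace Y. f y * inverse (g y)) \<in> Q Y B"
proof -
  obtain T where T: "surjective_linear_isometry Y (mult_module Y B f) (mult_module Y B g) T"
    and module: "\<And>b u. \<lbrakk>b \<in> B; u \<in> mult_module Y B f\<rbrakk>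
      \<Longrightarrow> T (\<lambda>y\<in>topspace Y. b y * u y) = (\<lambda>y\<in>topspace Y. b y * T u y)"
    using iso unfolding module_isometric_def by blast
  interpret mult_module_isometry Y B f g T
    by unfold_locales (use f g T in auto)
  \<comment> \<open>The generator of \<open>E\<close>, with the factor 1 spelled out to match
    \<open>mult_moduleI\<close>.\<close>
  define u where "u = (\<lambda>y\<in>topspace Y. (\<lambda>y\<in>topspace Y. 1) y * complex_of_real (f y))"
  have u: "u \<in> E"
    unfolding u_def by (rule mult_moduleI[OF const])
  obtain h where h: "h \<in> B" "T u = (\<lambda>y\<in>topspace Y. h y * of_real (g y))"
    using mult_moduleE[OF T_in[OF u]] by metis
  have Tb: "T (\<lambda>y\<in>topspace Y. b y * of_real (f y)) = (\<lambda>y\<in>topspace Y. b y * (h y * of_real (g y)))"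
    if "b \<in> B" for b
  proof -
    have "(\<lambda>y\<in>topspace Y. b y * of_real (f y)) = (\<lambda>y\<in>topspace Y. b y * u y)"
      by (auto simp: u_def)
    then show ?thesis
      by (auto simp: module[OF that u] h(2))
  qed
  \<comment> \<open>The preimage of the generator of \<open>F\<close> supplies the inverse
    \<open>k\<close> of \<open>h\<close>.\<close>
  have "(\<lambda>y\<in>topspace Y. (\<lambda>y\<in>topspace Y. 1) y * complex_of_real (g y)) \<in> F"
    by (rule mult_moduleI[OF const])
  then obtain v where v: "v \<in> E" "T v = (\<lambda>y\<in>topspace Y. (\<lambda>y\<in>topspace Y. 1) y * complex_of_real (g y))"
    using surj by metis
  obtain k where k: "k \<in> B" "v = (\<lambda>y\<in>topspace Y. k y * of_real (f y))"
    using mult_moduleE[OF v(1)] by metis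
  have inv: "h y * k y = 1" if y: "y \<in> topspace Y" for y
  proof -
    have "k y * (h y * of_real (g y)) = of_real (g y)"
      using v(2) y unfolding k(2) Tb[OF k(1)] by (auto simp: fun_eq_iff dest!: spec[of _ y])
    then show ?thesis
      using positive_functionsD(3)[OF g y] by (simp add: field_simps)
  qed
  have balls: "(\<forall>y\<in>topspace Y. cmod (b y) * (cmod (h y) * g y) \<le> 1) \<longleftrightarrow>
      (\<forall>y\<in>topspace Y. cmod (b y) * f y \<le> 1)" if "b \<in> B" for b
    using T_norm_le_iff[OF mult_moduleI[OF that, of f], of 1] positive_functionsD(3)[OF f]
      positive_functionsD(3)[OF g]
    by (simp add: Tb[OF that] norm_mult abs_of_pos)
  have contf: "continuous_map Y euclidean f"
    and conth: "continuous_map Y euclidean (\<lambda>y. cmod (h y) * g y)"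
    using positive_functionsD(2)[OF f] positive_functionsD(2)[OF g] cont[OF h(1)]
    by (auto intro!: continuous_intros)
  have posh: "0 < cmod (h y) * g y" if y: "y \<in> topspace Y" for y
    using inv[OF y] positive_functionsD(3)[OF g y] by (cases "h y = 0") auto
  have eq: "f y = cmod (h y) * g y" if y: "y \<in> topspace Y" for y
  proof (rule antisym)
    show "f y \<le> cmod (h y) * g y"
      by (rule weight_le_if_unit_balls_subset[OF contf conth posh _ y]) (use balls in auto)
    show "cmod (h y) * g y \<le> f y"
      by (rule weight_le_if_unit_balls_subset[OF conth contf positive_functionsD(3)[OF f] _ y])
        (use balls in auto)
  qed
  have "h \<in> invertibles Y B"
    unfolding invertibles_def using inv h k by blast
  moreover have "(\<lambda>y\<in>topspace Y. f y * inverse (g y)) = (\<lambda>y\<in>topspace Y. cmod (h y))"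
  proof (rule restrict_ext)
    fix y
    assume "y \<in> topspace Y"
    then show "f y * inverse (g y) = cmod (h y)"
      using eq[of y] positive_functionsD(3)[OF g, of y] by (simp add: mult.assoc)
  qed
  ultimately show ?thesis
    unfolding Q_def by blast
qed

text \<open>Multiplication by \<open>h g / f\<close> is isometric because
  \<open>f / g = \<bar>h\<bar>\<close> makes this function unimodular. It carries \<open>b f\<close>
  to \<open>b h g\<close>, and is onto because \<open>h\<close> is invertible.\<close>

lemma quotient_in_Q_imp_module_isometric:
  assumes f: "f \<in> positive_functions Y" and g: "g \<in> positive_functions Y"
    and "(\<lambda>y\<in>topspace Y. f y * inverse (g y)) \<in> Q Y B"
  shows "module_isometric Y B (mult_module Y B f) (mult_module Y B g)"
proof -
  obtain h k where h: "h \<in> B" and k: "k \<in> B" and inv: "\<And>y. y \<in> topspace Y \<Longrightarrow> h y * k y = 1"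
    and eq: "(\<lambda>y\<in>topspace Y. f y * inverse (g y)) = (\<lambda>y\<in>topspace Y. cmod (h y))"
    using assms(3) unfolding Q_def invertibles_def by blast
  have pos: "0 < f y" "0 < g y" if "y \<in> topspace Y" for y
    using positive_functionsD(3)[OF f that] positive_functionsD(3)[OF g that] by auto
  define m where "m y = h y * of_real (g y) / of_real (f y)" for y
  have m: "cmod (m y) = 1" if y: "y \<in> topspace Y" for y
  proof -
    have "f y * inverse (g y) = cmod (h y)"
      using fun_cong[OF eq, of y] y by simp
    then show ?thesis
      using pos[OF y] inv[OF y] by (cases "h y = 0") (auto simp: m_def norm_mult norm_divide field_simps)
  qed
  define T where "T u = (\<lambda>y\<in>topspace Y. m y * u y)" for u
  have Tb: "T (\<lambda>y\<in>topspace Y. b y * of_real (f y)) =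
      (\<lambda>y\<in>topspace Y. (\<lambda>y\<in>topspace Y. b y * h y) y * of_real (g y))" for b
    unfolding T_def
  proof (rule restrict_ext)
    fix y
    assume "y \<in> topspace Y"
    then show "m y * (\<lambda>y\<in>topspace Y. b y * of_real (f y)) y =
        (\<lambda>y\<in>topspace Y. b y * h y) y * of_real (g y)"
      using pos(1)[of y] by (simp add: m_def)
  qed
  have image: "T ` mult_module Y B f = mult_module Y B g"
  proof
    show "T ` mult_module Y B f \<subseteq> mult_module Y B g"
    proof
      fix v
      assume "v \<in> T ` mult_module Y B f"
      then obtain u where "u \<in> mult_module Y B f" "v = T u"
        by blast
      then obtain b where b: "b \<in> B" "v = T (\<lambda>y\<in>topspace Y. b y * of_real (f y))"
        using mult_moduleE[of u f] by metis
      show "v \<in> mult_module Y B g"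
        unfolding b(2) Tb by (rule mult_moduleI[OF mult[OF b(1) h]])
    qed
    show "mult_module Y B g \<subseteq> T ` mult_module Y B f"
    proof
      fix v
      assume "v \<in> mult_module Y B g"
      then obtain b where b: "b \<in> B" "v = (\<lambda>y\<in>topspace Y. b y * of_real (g y))"
        by (rule mult_moduleE)
      define c where "c = (\<lambda>y\<in>topspace Y. b y * k y)"
      have "c \<in> B"
        unfolding c_def using b(1) k by (rule mult)
      moreover have "v = T (\<lambda>y\<in>topspace Y. c y * of_real (f y))"
      proof -
        have "c y * h y = b y" if "y \<in> topspace Y" for y
          using inv[OF that] that by (simp add: c_def mult.assoc mult.commute[of "k y"])
        then show ?thesis
          unfolding Tb b(2) by (auto simp: restrict_def fun_eq_iff)
      qed
      ultimately show "v \<in> T ` mult_module Y B f"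
        using mult_moduleI[of c f] by blast
    qed
  qed
  have mdist: "mdist (CC Y) (T u) (T v) = mdist (CC Y) u v"
    if u: "u \<in> mult_module Y B f" and v: "v \<in> mult_module Y B f" for u v
  \<comment> \<open>The description of the distance by pointwise bounds is for nonempty spaces; on
    the empty one \<open>T\<close> fixes every element.\<close>
  proof (cases "topspace Y = {}")
    case True
    then have "T u = u" "T v = v"
      using mult_module_ext[OF u] mult_module_ext[OF v] by (auto simp: T_def extensional_def)
    then show ?thesis by simp
  next
    case False
    have "T u \<in> mspace (CC Y)" "T v \<in> mspace (CC Y)"
      using image u v mult_module_mspace[OF g] by blast+
    moreover have "u \<in> mspace (CC Y)" "v \<in> mspace (CC Y)"
      using u v mult_module_mspace[OF f] by blast+
    moreover have "dist (T u y) (T v y) = dist (u y) (v y)" if y: "y \<in> topspace Y" for y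
      using y m[OF y] by (simp add: T_def dist_norm norm_mult flip: right_diff_distrib)
    \<comment> \<open>Two reals with the same upper bounds are equal, so no supremum has to be
      computed.\<close>
    ultimately have "mdist (CC Y) (T u) (T v) \<le> c \<longleftrightarrow> mdist (CC Y) u v \<le> c" for c
      using False by (simp add: cfunspace_mdist_le del: mspace_cfunspace)
    then show ?thesis
      by (meson antisym order_refl)
  qed
  have T_mult: "T (\<lambda>y\<in>topspace Y. c y * u y) = (\<lambda>y\<in>topspace Y. c y * T u y)" for c u
    unfolding T_def by (rule restrict_ext) simp
  have T_add: "T (\<lambda>y\<in>topspace Y. u y + v y) = (\<lambda>y\<in>topspace Y. T u y + T v y)" for u v
    unfolding T_def by (rule restrict_ext) (simp add: distrib_left)
  have "surjective_linear_isometry Y (mult_module Y B f) (mult_module Y B g) T"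
    unfolding surjective_linear_isometry_def
    by (intro conjI ballI allI image mdist T_add T_mult)
  then show ?thesis
    unfolding module_isometric_def by (intro exI[of _ T] conjI ballI T_mult)
qed

text \<open>An isometry from \<open>B\<close> to the module of \<open>f\<close> has quotient
  \<open>1 / f\<close>, so reciprocals must stay in \<open>Q\<close>; they do because the inverse
  algebra element has the reciprocal modulus. The factor 1 is the form in which weight 1 enters the
  quotient.\<close>

lemma Q_inverse:
  assumes "f \<in> Q Y B"
  shows "(\<lambda>y\<in>topspace Y. (\<lambda>y\<in>topspace Y. 1) y * inverse (f y)) \<in> Q Y B"
proof -
  obtain h k where h: "h \<in> B" and k: "k \<in> B" and inv: "\<And>y. y \<in> topspace Y \<Longrightarrow> h y * k y = 1"
    and f: "f = (\<lambda>y\<in>topspace Y. cmod (h y))"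
    using assms unfolding Q_def invertibles_def by blast
  have "k \<in> invertibles Y B"
    unfolding invertibles_def using h k inv by (auto simp: mult.commute)
  moreover have "inverse (cmod (h y)) = cmod (k y)" if "y \<in> topspace Y" for y
    using inverse_unique[OF inv[OF that]] by (metis norm_inverse)
  then have "(\<lambda>y\<in>topspace Y. (\<lambda>y\<in>topspace Y. 1) y * inverse (f y)) = (\<lambda>y\<in>topspace Y. cmod (k y))"
    by (auto simp: f restrict_def fun_eq_iff)
  ultimately show ?thesis
    unfolding Q_def by blast
qed

lemma Q_imp_module_isometric:
  assumes "f \<in> positive_functions Y" "f \<in> Q Y B"
  shows "module_isometric Y B B (mult_module Y B f)"
  using quotient_in_Q_imp_module_isometric[OF one_positive assms(1) Q_inverse[OF assms(2)]]
  unfolding mult_module_one .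

end

theorem corollary3p7:
  fixes X \<Omega> :: "'x topology" and A B :: "('x \<Rightarrow> complex) set"
  assumes "uniform_algebra X A"
    and "\<Omega> = subtopology X (shilov_boundary X A)"
    and "B = restrict_algebra A \<Omega>"
  shows "(\<forall>f \<in> positive_functions \<Omega>.
            (f \<in> Q \<Omega> B \<longleftrightarrow> module_isometric \<Omega> B B (mult_module \<Omega> B f)) \<and>
            (module_isometric \<Omega> B B (mult_module \<Omega> B f) \<longleftrightarrow>
               linearly_isometric \<Omega> B (mult_module \<Omega> B f))) \<and>
         (\<forall>f\<^sub>1 \<in> positive_functions \<Omega>. \<forall>f\<^sub>2 \<in> positive_functions \<Omega>.
            module_isometric \<Omega> B (mult_module \<Omega> B f\<^sub>1) (mult_module \<Omega> B f\<^sub>2) \<longleftrightarrow>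
            (\<lambda>\<omega>\<in>topspace \<Omega>. f\<^sub>1 \<omega> * inverse (f\<^sub>2 \<omega>)) \<in> Q \<Omega> B)"
proof -
  interpret boundary_algebra \<Omega> B
    unfolding assms(3) by (rule uniform_algebra.boundary_algebra_shilov[OF assms(1,2)])
  \<comment> \<open>This closes the cycle: membership in \<open>Q\<close>, module isometry, linear
    isometry, and back to \<open>Q\<close>.\<close>
  have "module_isometric \<Omega> B B F \<Longrightarrow> linearly_isometric \<Omega> B F" for F
    unfolding module_isometric_def linearly_isometric_def by blast
  then show ?thesis
    using Q_imp_module_isometric linearly_isometric_imp_Q
      module_isometric_imp_quotient_in_Q quotient_in_Q_imp_module_isometric by blast
qed

end
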